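(* Let $q\ge 2$ and $m\ge 2$ be integers, and let $h_i,h_i':\mathbb{Z}_q\to\mathbb{Z}_q$ ($i=1,\dots,m-1$) be functions. For any choice of functions $g_j:\mathbb{Z}_q\to\mathbb{Z}_q$ ($j=1,\dots,m$) and any permutation $\pi$ of $\{1,2,\dots,m\}$, let $f:\mathbb{Z}_q^m\to\mathbb{Z}_q$ be given by $$f(x_1,\dots,x_m)=\sum_{i=1}^{m-1}h_i(x_{\pi(i)})\,h_i'(x_{\pi(i+1)})+\sum_{j=1}^m g_j(x_j),$$ and for $t\in\mathbb{Z}_q$ let $$\psi(C_t)=\big\{\psi\big(f+d\,x_{\pi(1)}+t\,x_{\pi(m)}\big): d\in\mathbb{Z}_q\big\}.$$ Then the set of codes $\mathcal{C}=\{\psi(C_t): t\in\mathbb{Z}_q\}$ forms $(q,q^m)$-CCCs if and only if $h_i$ and $h_i'$ are permutations of $\mathbb{Z}_q$ for every $i=1,2,\dots,m-1$.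
   Context: $\mathbb{Z}_q$ is the ring of integers modulo $q$, with elements represented by $0,1,\dots,q-1$; $\xi_q=\exp(2\pi\sqrt{-1}/q)$. Sequence of a function: for $F:\mathbb{Z}_q^m\to\mathbb{Z}_q$, $\psi(F)=(\xi_q^{F_0},\xi_q^{F_1},\dots,\xi_q^{F_{q^m-1}})$, where $F_x=F(x_1,\dots,x_m)$ and $(x_1,\dots,x_m)$ with $x_j\in\{0,\dots,q-1\}$ is determined by $x=\sum_{j=1}^m x_jq^{j-1}$. Aperiodic correlation: for complex sequences $\mathbf{a},\mathbf{b}$ of length $L$ and an integer $\tau$ with $|\tau|<L$, $\Theta(\mathbf{a},\mathbf{b})(\tau)=\sum_{s=0}^{L-\tau-1}a_s b_{s+\tau}^*$ if $0\le\tau<L$, and $\Theta(\mathbf{a},\mathbf{b})(\tau)=\sum_{s=0}^{L+\tau-1}a_{s-\tau}b_s^*$ if $-L<\tau<0$. A code is an ordered tuple of $M$ complex sequences of length $L$; for codes $\mathbf{C}=(\mathbf{c}^1,\dots,\mathbf{c}^M)$, $\mathbf{D}=(\mathbf{d}^1,\dots,\mathbf{d}^M)$ put $\Theta(\mathbf{C},\mathbf{D})(\tau)=\sum_{\ell=1}^M\Theta(\mathbf{c}^\ell,\mathbf{d}^\ell)(\tau)$. Here each code $\psi(C_t)$ is regarded as a tuple of sequences indexed by $d$, in the same order of $d$ for all $t$. $(M,L)$-CCCs (complete complementary codes): a family of $M$ codes $\mathbf{C}_1,\dots,\mathbf{C}_M$, each consisting of $M$ sequences of length $L$, such that $\Theta(\mathbf{C}_{k_1},\mathbf{C}_{k_2})(\tau)=ML$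 if $\tau=0$ and $k_1=k_2$; $=0$ if $0<|\tau|<L$ and $k_1=k_2$; and $=0$ if $|\tau|<L$ and $k_1\ne k_2$. *)

theory Defs
  imports Complex_Main "HOL-Library.FuncSet" "HOL-Combinatorics.Permutations"
begin

text \<open>
  The ring of integers modulo \<open>q\<close> is represented by the set of residues \<open>{..<q}\<close> of naturals,
  with ring operations computed in \<open>nat\<close> and reduced by \<open>mod q\<close>.
\<close>

text \<open>Vectors of length \<open>m\<close> over the residues, with coordinates numbered from \<open>1\<close> to \<open>m\<close>.\<close>

definition vecs :: "nat \<Rightarrow> nat \<Rightarrow> (nat \<Rightarrow> nat) set" where
  "vecs q m = {1..m} \<rightarrow>\<^sub>E {..<q}"

definition xi :: "nat \<Rightarrow> complex" where
  "xi q = exp (2 * of_real pi * \<i> / of_nat q)"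

definition digits :: "nat \<Rightarrow> nat \<Rightarrow> nat \<Rightarrow> (nat \<Rightarrow> nat)" where
  "digits q m x = (\<lambda>j\<in>{1..m}. (x div q ^ (j - 1)) mod q)"

text \<open>
  \<open>digits q m x\<close> is the unique vector whose coordinates are the base-\<open>q\<close> digits of \<open>x\<close>,
  least significant digit first.
\<close>

lemma sum_digits:
  "x < q ^ m \<Longrightarrow> (\<Sum>j<m. ((x div q ^ j) mod q) * q ^ j) = (x :: nat)"
proof (induction m arbitrary: x)
  case 0
  then show ?case by simp
next
  case (Suc m)
  have "x div q < q ^ m"
    using Suc.prems by (simp add: less_mult_imp_div_less mult.commute)
  then have IH: "(\<Sum>j<m. ((x div q div q ^ j) mod q) * q ^ j) = x div q"
    by (rule Suc.IH)
  have "(\<Sum>j<Suc m. ((x div q ^ j) mod q) * q ^ j) =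
        x mod q + q * (\<Sum>j<m. ((x div q div q ^ j) mod q) * q ^ j)"
    by (subst sum.lessThan_Suc_shift) (simp add: sum_distrib_left div_mult2_eq mult_ac)
  then show ?case
    by (simp only: IH mod_mult_div_eq)
qed

lemma digits_of_sum:
  "\<lbrakk>\<And>j. j < m \<Longrightarrow> v j < q; i < m\<rbrakk> \<Longrightarrow> ((\<Sum>j<m. v j * q ^ j) div q ^ i) mod q = (v i :: nat)"
proof (induction m arbitrary: v i)
  case 0
  then show ?case by simp
next
  case (Suc m)
  have v0: "v 0 < q" using Suc.prems(1)[of 0] by simp
  have eq: "(\<Sum>j<Suc m. v j * q ^ j) = v 0 + q * (\<Sum>j<m. v (Suc j) * q ^ j)"
    by (subst sum.lessThan_Suc_shift) (simp add: sum_distrib_left mult_ac)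
  show ?case
  proof (cases i)
    case 0
    then show ?thesis unfolding eq using v0 by simp
  next
    case (Suc k)
    have "(v 0 + q * (\<Sum>j<m. v (Suc j) * q ^ j)) div q ^ i =
          (\<Sum>j<m. v (Suc j) * q ^ j) div q ^ k"
      using v0 Suc by (simp add: div_mult2_eq)
    then show ?thesis
      unfolding eq using Suc.IH[of "\<lambda>j. v (Suc j)" k] Suc.prems Suc by simp
  qed
qed

lemma digits_unique:
  assumes "q > 0" "x < q ^ m"
  shows "v \<in> vecs q m \<and> x = (\<Sum>j = 1..m. v j * q ^ (j - 1)) \<longleftrightarrow> v = digits q m x"
proof -
  have shift: "(\<Sum>j = 1..m. w j * q ^ (j - 1)) = (\<Sum>j<m. w (Suc j) * q ^ j)" for w :: "nat \<Rightarrow> nat"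
    by (simp add: sum.atLeast1_atMost_eq)
  show ?thesis
  proof
    assume v: "v \<in> vecs q m \<and> x = (\<Sum>j = 1..m. v j * q ^ (j - 1))"
    show "v = digits q m x"
    proof
      fix i
      show "v i = digits q m x i"
      proof (cases "i \<in> {1..m}")
        case True
        then have "v (Suc (i - 1)) = (x div q ^ (i - 1)) mod q"
          using v digits_of_sum[of m "\<lambda>j. v (Suc j)" q "i - 1"]
          unfolding shift by (auto simp: vecs_def PiE_iff)
        then show ?thesis using True by (simp add: digits_def)
      next
        case False
        then show ?thesis using v by (auto simp: vecs_def digits_def PiE_iff extensional_def)
      qed
    qed
  next
    assume v: "v = digits q m x"
    have "(\<Sum>j = 1..m. v j * q ^ (j - 1)) = x"
      unfolding shift v using sum_digits[OF assms(2)] by (simp add: digits_def)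
    then show "v \<in> vecs q m \<and> x = (\<Sum>j = 1..m. v j * q ^ (j - 1))"
      using assms(1) v by (auto simp: vecs_def digits_def)
  qed
qed

text \<open>Sequences are lists of complex numbers; codes are lists of sequences.\<close>

definition psi :: "nat \<Rightarrow> nat \<Rightarrow> ((nat \<Rightarrow> nat) \<Rightarrow> nat) \<Rightarrow> complex list" where
  "psi q m F = map (\<lambda>x. xi q ^ F (digits q m x)) [0..<q ^ m]"

text \<open>
  Only used for sequences of equal length \<open>L\<close> and \<open>\<bar>\<tau>\<bar> < L\<close>.
\<close>

definition aper_corr :: "complex list \<Rightarrow> complex list \<Rightarrow> int \<Rightarrow> complex" where
  "aper_corr a b \<tau> =
     (if 0 \<le> \<tau>
      then \<Sum>s<nat (int (length a) - \<tau>). a ! s * cnj (b ! (s + nat \<tau>))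
      else \<Sum>s<nat (int (length a) + \<tau>). a ! (s + nat (- \<tau>)) * cnj (b ! s))"

definition code_corr :: "complex list list \<Rightarrow> complex list list \<Rightarrow> int \<Rightarrow> complex" where
  "code_corr C D \<tau> = (\<Sum>l<length C. aper_corr (C ! l) (D ! l) \<tau>)"

definition is_CCC :: "nat \<Rightarrow> nat \<Rightarrow> complex list list list \<Rightarrow> bool" where
  "is_CCC M L Cs \<longleftrightarrow>
     length Cs = M \<and>
     (\<forall>C\<in>set Cs. length C = M \<and> (\<forall>c\<in>set C. length c = L)) \<and>
     (\<forall>k1<M. \<forall>k2<M. \<forall>\<tau>::int. \<bar>\<tau>\<bar> < int L \<longrightarrow>
        code_corr (Cs ! k1) (Cs ! k2) \<tau> =
          (if \<tau> = 0 \<and> k1 = k2 then of_nat (M * L) else 0))"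

definition base_fun ::
  "nat \<Rightarrow> nat \<Rightarrow> (nat \<Rightarrow> nat \<Rightarrow> nat) \<Rightarrow> (nat \<Rightarrow> nat \<Rightarrow> nat) \<Rightarrow> (nat \<Rightarrow> nat \<Rightarrow> nat) \<Rightarrow>
   (nat \<Rightarrow> nat) \<Rightarrow> (nat \<Rightarrow> nat) \<Rightarrow> nat" where
  "base_fun q m h h' g \<pi> x =
     ((\<Sum>i = 1..m - 1. h i (x (\<pi> i)) * h' i (x (\<pi> (i + 1)))) + (\<Sum>j = 1..m. g j (x j))) mod q"

definition psi_code ::
  "nat \<Rightarrow> nat \<Rightarrow> ((nat \<Rightarrow> nat) \<Rightarrow> nat) \<Rightarrow> (nat \<Rightarrow> nat) \<Rightarrow> nat \<Rightarrow> complex list list" where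
  "psi_code q m f \<pi> t =
     map (\<lambda>d. psi q m (\<lambda>x. (f x + d * x (\<pi> 1) + t * x (\<pi> m)) mod q)) [0..<q]"

end

theory Submission
  imports Defs
begin

text \<open>
  Summing over \<open>d\<close> restricts a correlation to pairs of vectors that agree in the coordinate
  \<open>\<pi>(1)\<close>, and Fourier inversion in \<open>t\<close> fixes both values of the coordinate \<open>\<pi>(m)\<close>. What remains are
  the sums \<open>S\<^sub>m(\<tau>; a, b)\<close> of \<open>\<xi>\<^bsup>f(u)-f(v)\<^esup>\<close> over pairs with displacement \<open>\<tau>\<close> and
  last coordinates \<open>a\<close>, \<open>b\<close>, and the codes are complete complementary iff
  \<open>S\<^sub>m\<close> vanishes for all \<open>\<tau> \<noteq> 0\<close>. Splitting off the last vertex of the path expresses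
  \<open>S\<^sub>k\<^sub>+\<^sub>1(\<tau>; a, b)\<close> as a Fourier-type transform of \<open>S\<^sub>k\<close> at the displacement
  \<open>\<tau> - (b - a) q\<^bsup>e(k+1)\<^esup>\<close>, where \<open>e(i) = \<pi>(i) - 1\<close>. Since \<open>S\<^sub>k(0; y, y')\<close> is \<open>q\<^bsup>k-1\<^esup>\<close> on the diagonal and \<open>0\<close> off it, \<open>S\<^sub>k\<^sub>+\<^sub>1\<close> vanishes
  off \<open>\<tau> = 0\<close> iff \<open>S\<^sub>k\<close> does and both \<open>h\<^sub>k\<close>, \<open>h'\<^sub>k\<close> are permutations.
\<close>

section \<open>Additive characters\<close>

lemma xi_power: "xi q ^ n = cis (2 * pi * real n / real q)"
proof -
  have "xi q = cis (2 * pi / real q)"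
    by (simp add: xi_def cis_conv_exp mult_ac)
  then show ?thesis by (simp add: DeMoivre mult_ac)
qed

lemma xi_nonzero [simp]: "xi q \<noteq> 0"
  by (simp add: xi_def)

lemma xi_power_period: "q > 0 \<Longrightarrow> xi q ^ q = 1"
  by (simp add: xi_power)

lemma xi_power_mod: "q > 0 \<Longrightarrow> xi q ^ (n mod q) = xi q ^ n"
proof -
  assume q: "q > 0"
  have "xi q ^ n = xi q ^ (q * (n div q) + n mod q)" by simp
  also have "\<dots> = xi q ^ (n mod q)"
    using q by (simp only: power_add power_mult xi_power_period power_one mult_1)
  finally show ?thesis by simp
qed

lemma xi_cnj: "xi q ^ n * cnj (xi q ^ n) = 1"
  by (simp add: xi_power cis_cnj cis_mult)

lemma xi_power_inj:
  assumes "xi q ^ a = xi q ^ b" "a < q" "b < q"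
  shows "a = b"
proof -
  have "inj_on (\<lambda>k. cis (2 * pi * real k / real q)) {..<q}"
    using bij_betw_roots_unity[of q] assms by (auto simp: bij_betw_def)
  then show ?thesis
    using assms by (auto simp: xi_power dest: inj_onD)
qed

text \<open>The terms are powers of the ratio \<open>z\<close>, a \<open>q\<close>-th root of unity
  equal to 1 only for \<open>a = b\<close>; otherwise the geometric sum is 0.\<close>

lemma character_orthogonality:
  assumes "a < q" "b < q"
  shows "(\<Sum>s<q. xi q ^ (s * a) * cnj (xi q ^ (s * b))) = of_nat q * of_bool (a = b)"
proof -
  define z where "z = xi q ^ a * cnj (xi q ^ b)"
  have z: "xi q ^ (s * a) * cnj (xi q ^ (s * b)) = z ^ s" for s
    by (simp add: z_def power_mult_distrib mult.commute flip: power_mult)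
  show ?thesis
  proof (cases "a = b")
    case True
    then show ?thesis by (simp add: xi_cnj del: complex_cnj_power)
  next
    case False
    have "z \<noteq> 1"
    proof
      assume "z = 1"
      then have "xi q ^ a * cnj (xi q ^ b) = xi q ^ b * cnj (xi q ^ b)"
        by (simp only: z_def xi_cnj)
      then have "xi q ^ a = xi q ^ b"
        by simp
      with assms False show False by (blast dest: xi_power_inj)
    qed
    moreover have "z ^ q = 1"
    proof -
      have "z ^ q = (xi q ^ q) ^ a * cnj ((xi q ^ q) ^ b)"
        by (simp add: z_def power_mult_distrib mult.commute flip: power_mult)
      then show ?thesis using assms by (simp add: xi_power_period)
    qed
    ultimately show ?thesis
      using False unfolding z by (simp add: geometric_sum)
  qed
qed

section \<open>Kernels built from two maps of the residues: orthogonality, inversion,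
  converse\<close>

lemma bij_betw_lessThanI:
  assumes "f \<in> {..<q} \<rightarrow> {..<q::nat}" "inj_on f {..<q}"
  shows "bij_betw f {..<q} {..<q}"
  using assms by (simp add: bij_betw_def endo_inj_surj image_subset_iff Pi_iff)

text \<open>Running through the values of \<open>h\<close> is running through all residues, so this
  is a plain character sum; injectivity of \<open>h'\<close> brings the result back to
  \<open>a\<close> and \<open>b\<close>.\<close>

lemma kernel_orthogonality:
  assumes h: "bij_betw h {..<q} {..<q}" and h': "bij_betw h' {..<q} {..<q}"
    and "a < q" "b < q"
  shows "(\<Sum>c<q. xi q ^ (h c * h' a) * cnj (xi q ^ (h c * h' b))) = of_nat q * of_bool (a = b)"
proof -
  have "(\<Sum>c<q. xi q ^ (h c * h' a) * cnj (xi q ^ (h c * h' b)))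
      = (\<Sum>s<q. xi q ^ (s * h' a) * cnj (xi q ^ (s * h' b)))"
    by (rule sum.reindex_bij_betw[OF h])
  also have "\<dots> = of_nat q * of_bool (h' a = h' b)"
    using assms by (intro character_orthogonality) (auto simp: bij_betw_def)
  also have "h' a = h' b \<longleftrightarrow> a = b"
    using assms by (auto simp: bij_betw_def inj_on_def)
  finally show ?thesis .
qed

text \<open>For permutations the kernel is the discrete Fourier matrix with rows and columns
  permuted, hence invertible; multiplying by its conjugate transpose isolates
  \<open>G y0\<close>.\<close>

lemma kernel_inversion:
  assumes h: "bij_betw h {..<q} {..<q}" and h': "bij_betw h' {..<q} {..<q}"
    and zero: "\<And>a. a < q \<Longrightarrow> (\<Sum>y<q. xi q ^ (h y * h' a) * G y) = 0"
    and "y0 < q"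
  shows "G y0 = 0"
proof -
  have "0 = (\<Sum>a<q. cnj (xi q ^ (h y0 * h' a)) * (\<Sum>y<q. xi q ^ (h y * h' a) * G y))"
    by (simp add: zero)
  also have "\<dots> = (\<Sum>y<q. G y * (\<Sum>a<q. xi q ^ (h' a * h y) * cnj (xi q ^ (h' a * h y0))))"
    unfolding sum_distrib_left by (subst sum.swap) (simp add: mult_ac)
  \<comment> \<open>The inner sum runs over the argument of \<open>h'\<close>, so orthogonality is
    used with the roles of \<open>h\<close> and \<open>h'\<close> exchanged.\<close>
  also have "\<dots> = (\<Sum>y<q. G y * (of_nat q * of_bool (y = y0)))"
    using kernel_orthogonality[OF h' h] \<open>y0 < q\<close> by (intro sum.cong) auto
  also have "\<dots> = (\<Sum>y<q. if y = y0 then G y * of_nat q else 0)"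
    by (intro sum.cong) auto
  also have "\<dots> = G y0 * of_nat q"
    using \<open>y0 < q\<close> by simp
  finally show ?thesis using \<open>y0 < q\<close> by simp
qed

text \<open>Inversion one variable at a time. The second kernel occurs conjugated, so the equation
  is conjugated before the second inversion.\<close>

lemma kernel_inversion2:
  assumes h: "bij_betw h {..<q} {..<q}" and h': "bij_betw h' {..<q} {..<q}"
    and zero: "\<And>a b. a < q \<Longrightarrow> b < q \<Longrightarrow>
      (\<Sum>y<q. \<Sum>y'<q. xi q ^ (h y * h' a) * cnj (xi q ^ (h y' * h' b)) * G y y') = 0"
    and "y < q" "y' < q"
  shows "G y y' = 0"
proof -
  have *: "(\<Sum>y'<q. cnj (xi q ^ (h y' * h' b)) * G y y') = 0" if "b < q" for b
  proof (rule kernel_inversion[where G = "\<lambda>y. \<Sum>y'<q. cnj (xi q ^ (h y' * h' b)) * G y y'",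
        OF h h' _ \<open>y < q\<close>])
    fix a assume "a < q"
    then show "(\<Sum>y<q. xi q ^ (h y * h' a) * (\<Sum>y'<q. cnj (xi q ^ (h y' * h' b)) * G y y')) = 0"
      using zero[OF _ \<open>b < q\<close>, of a] by (simp only: sum_distrib_left mult.assoc)
  qed
  have "(\<Sum>y'<q. xi q ^ (h y' * h' b) * cnj (G y y')) = 0" if "b < q" for b
    using arg_cong[OF *[OF that], of cnj] by simp
  then have "cnj (G y y') = 0"
    by (rule kernel_inversion[where G = "\<lambda>y'. cnj (G y y')", OF h h' _ \<open>y' < q\<close>])
  then show ?thesis by simp
qed

text \<open>A collision of \<open>h'\<close> would make every summand 1 and the sum
  \<open>q\<close>. Once \<open>h'\<close> is onto, all nontrivial character sums over the values of
  \<open>h\<close> vanish, so these values are equidistributed and \<open>h\<close> is onto.\<close>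

lemma bij_of_kernel_orthogonality:
  assumes h: "h \<in> {..<q} \<rightarrow> {..<q}" and h': "h' \<in> {..<q} \<rightarrow> {..<q}"
    and zero: "\<And>a b. a < q \<Longrightarrow> b < q \<Longrightarrow> a \<noteq> b \<Longrightarrow>
      (\<Sum>c<q. xi q ^ (h c * h' a) * cnj (xi q ^ (h c * h' b))) = 0"
  shows "bij_betw h {..<q} {..<q} \<and> bij_betw h' {..<q} {..<q}"
proof
  have "inj_on h' {..<q}"
  proof (rule inj_onI, rule ccontr)
    fix a b assume ab: "a \<in> {..<q}" "b \<in> {..<q}" "h' a = h' b" "a \<noteq> b"
    then have "(\<Sum>c<q. xi q ^ (h c * h' a) * cnj (xi q ^ (h c * h' b))) = of_nat q"
      by (simp add: xi_cnj del: complex_cnj_power)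
    with ab zero[of a b] show False by simp
  qed
  with h' show bij': "bij_betw h' {..<q} {..<q}" by (rule bij_betw_lessThanI)
  have "{..<q} \<subseteq> h ` {..<q}"
  proof
    fix w assume w: "w \<in> {..<q}"
    \<comment> \<open>Orthogonality between the preimages of \<open>s\<close> and of 0 under
      \<open>h'\<close>: the second factor becomes 1 and a single character remains.\<close>
    have zero': "(\<Sum>c<q. xi q ^ (s * h c)) = of_nat q * of_bool (s = 0)" if "s < q" for s
    proof (cases "s = 0")
      case False
      have "s \<in> h' ` {..<q}" "0 \<in> h' ` {..<q}"
        using bij' that by (auto simp: bij_betw_def)
      then obtain a b where ab: "a < q" "b < q" "h' a = s" "h' b = 0" by auto
      with False have "a \<noteq> b" by auto
      with zero[of a b] ab False show ?thesis by (simp add: mult.commute)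
    qed simp
    \<comment> \<open>Evaluated in two orders, the double sum is \<open>q\<close> times the number
      of \<open>c\<close> with \<open>h c = w\<close>, and also \<open>q\<close>, since only
      \<open>s = 0\<close> survives.\<close>
    have "(\<Sum>c<q. \<Sum>s<q. xi q ^ (s * h c) * cnj (xi q ^ (s * w)))
        = (\<Sum>s<q. (\<Sum>c<q. xi q ^ (s * h c)) * cnj (xi q ^ (s * w)))"
      by (subst sum.swap) (simp add: sum_distrib_right)
    also have "\<dots> = (\<Sum>s<q. if s = 0 then of_nat q else 0)"
      by (intro sum.cong) (auto simp: zero')
    also have "\<dots> = of_nat q"
      using w by simp
    finally have sum: "(\<Sum>c<q. \<Sum>s<q. xi q ^ (s * h c) * cnj (xi q ^ (s * w))) = of_nat q" .
    show "w \<in> h ` {..<q}"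
    proof (rule ccontr)
      assume "w \<notin> h ` {..<q}"
      then have "(\<Sum>s<q. xi q ^ (s * h c) * cnj (xi q ^ (s * w))) = 0" if "c < q" for c
      proof -
        have "h c < q" "h c \<noteq> w" using \<open>w \<notin> h ` {..<q}\<close> that h by auto
        with character_orthogonality[of "h c" q w] w show ?thesis by simp
      qed
      with sum w show False by simp
    qed
  qed
  with h have "h ` {..<q} = {..<q}" by auto
  then show "bij_betw h {..<q} {..<q}"
    by (simp add: bij_betw_def eq_card_imp_inj_on)
qed

section \<open>Signed base-\<open>q\<close> expansions\<close>

text \<open>Take the nonzero digit with the least exponent. All other terms are divisible by a
  higher power of \<open>q\<close>, so \<open>q\<close> divides this digit, against its bound.
  Exponents are only injective, not ordered, because a path may visit the digit positions in any
  order.\<close>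

lemma signed_digits_zero:
  fixes \<delta> :: "'a \<Rightarrow> int" and q :: nat
  assumes I: "finite I" and e: "inj_on e I"
    and bound: "\<And>i. i \<in> I \<Longrightarrow> \<bar>\<delta> i\<bar> < int q"
    and sum0: "(\<Sum>i\<in>I. \<delta> i * int q ^ e i) = 0" and "j \<in> I"
  shows "\<delta> j = 0"
proof (rule ccontr)
  assume "\<delta> j \<noteq> 0"
  define N where "N = {i \<in> I. \<delta> i \<noteq> 0}"
  have "j \<in> N" using \<open>j \<in> I\<close> \<open>\<delta> j \<noteq> 0\<close> by (simp add: N_def)
  then obtain k where k: "k \<in> N" "\<And>i. i \<in> N \<Longrightarrow> e k \<le> e i"
    using ex_has_least_nat[of "\<lambda>i. i \<in> N" j e] by blast
  have kI: "k \<in> I" "\<delta> k \<noteq> 0" using k by (auto simp: N_def)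
  have "int q ^ Suc (e k) dvd (\<Sum>i\<in>I - {k}. \<delta> i * int q ^ e i)"
  proof (rule dvd_sum)
    fix i assume i: "i \<in> I - {k}"
    show "int q ^ Suc (e k) dvd \<delta> i * int q ^ e i"
    proof (cases "\<delta> i = 0")
      case False
      then have "e k \<le> e i" "e k \<noteq> e i"
        using i k(2)[of i] kI e by (auto simp: N_def inj_on_def)
      then show ?thesis by (intro dvd_mult le_imp_power_dvd) simp
    qed simp
  qed
  moreover have "\<delta> k * int q ^ e k = - (\<Sum>i\<in>I - {k}. \<delta> i * int q ^ e i)"
    using sum0 by (simp add: sum.remove[OF I kI(1)] eq_neg_iff_add_eq_0)
  ultimately have "int q * int q ^ e k dvd \<delta> k * int q ^ e k" by simp
  moreover have "q > 0" using bound[OF kI(1)] by linarith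
  ultimately have "int q dvd \<delta> k" by simp
  with bound[OF kI(1)] kI(2) show False by (auto dest: zdvd_imp_le dvd_imp_le_int)
qed

section \<open>Correlation sums along a path\<close>

lemma finite_vecs [simp]: "finite (vecs q k)"
  by (simp add: vecs_def finite_PiE)

lemma sum_of_bool_lessThan:
  fixes F :: "nat \<Rightarrow> complex"
  assumes "y < q"
  shows "(\<Sum>x<q. of_bool (x = y) * F x) = F y" "(\<Sum>x<q. of_bool (y = x) * F x) = F y"
proof -
  have "(\<Sum>x<q. of_bool (x = y) * F x) = (\<Sum>x<q. if x = y then F x else 0)"
    by (intro sum.cong) auto
  with assms show "(\<Sum>x<q. of_bool (x = y) * F x) = F y" by simp
  then show "(\<Sum>x<q. of_bool (y = x) * F x) = F y" by (simp only: eq_commute)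
qed

lemma sum_vecs_Suc:
  "(\<Sum>u\<in>vecs q (Suc k). F u) = (\<Sum>u\<in>vecs q k. \<Sum>a<q. F (u(Suc k := a)))"
proof -
  have eq: "{1..Suc k} = insert (Suc k) {1..k}" by auto
  have "(\<Sum>u\<in>vecs q (Suc k). F u) = (\<Sum>(a, u)\<in>{..<q} \<times> vecs q k. F (u(Suc k := a)))"
    unfolding vecs_def eq PiE_insert_eq
    by (subst sum.reindex, rule inj_combinator) (simp_all add: case_prod_unfold)
  also have "\<dots> = (\<Sum>u\<in>vecs q k. \<Sum>a<q. F (u(Suc k := a)))"
    by (subst sum.swap) (simp add: sum.cartesian_product)
  finally show ?thesis .
qed

text \<open>Vectors are indexed by position along the path, so edges join \<open>i\<close> and
  \<open>i + 1\<close>; the permutation survives only in the exponents \<open>e\<close> and in the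
  reindexed \<open>g\<close>.\<close>

locale path_function =
  fixes q m :: nat and h h' g :: "nat \<Rightarrow> nat \<Rightarrow> nat" and e :: "nat \<Rightarrow> nat"
  assumes q: "q > 0"
    and h: "\<And>i. i \<in> {1..m - 1} \<Longrightarrow> h i \<in> {..<q} \<rightarrow> {..<q}"
    and h': "\<And>i. i \<in> {1..m - 1} \<Longrightarrow> h' i \<in> {..<q} \<rightarrow> {..<q}"
    and e: "inj_on e {1..m}"
begin

text \<open>The function \<open>f\<close> cut down to the first \<open>k\<close> vertices, left
  unreduced since it only occurs as an exponent of \<open>xi q\<close>.\<close>

definition chain :: "nat \<Rightarrow> (nat \<Rightarrow> nat) \<Rightarrow> nat" where
  "chain k u = (\<Sum>i = 1..k - 1. h i (u i) * h' i (u (i + 1))) + (\<Sum>i = 1..k. g i (u i))"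

definition disp :: "nat \<Rightarrow> (nat \<Rightarrow> nat) \<Rightarrow> (nat \<Rightarrow> nat) \<Rightarrow> int" where
  "disp k u v = (\<Sum>i = 1..k. (int (v i) - int (u i)) * int q ^ e i)"

definition phase :: "nat \<Rightarrow> (nat \<Rightarrow> nat) \<Rightarrow> (nat \<Rightarrow> nat) \<Rightarrow> complex" where
  "phase k u v = xi q ^ chain k u * cnj (xi q ^ chain k v)"

definition S :: "nat \<Rightarrow> int \<Rightarrow> nat \<Rightarrow> nat \<Rightarrow> complex" where
  "S k \<tau> a b = (\<Sum>u\<in>vecs q k. \<Sum>v\<in>vecs q k.
     of_bool (u 1 = v 1 \<and> disp k u v = \<tau>) * of_bool (a = u k) * of_bool (b = v k) * phase k u v)"

definition vanishing :: "nat \<Rightarrow> bool" where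
  "vanishing k \<longleftrightarrow> (\<forall>\<tau> a b. \<tau> \<noteq> 0 \<longrightarrow> a < q \<longrightarrow> b < q \<longrightarrow> S k \<tau> a b = 0)"

text \<open>Weights depending only on the two last coordinates pass through \<open>S\<close>. They
  are the edge kernel in the recursion and the characters in \<open>t\<close>, \<open>t'\<close> for
  the codes.\<close>

lemma sum_S:
  assumes "k \<ge> 1"
  shows "(\<Sum>a<q. \<Sum>b<q. c a b * S k \<tau> a b) =
    (\<Sum>u\<in>vecs q k. \<Sum>v\<in>vecs q k. of_bool (u 1 = v 1 \<and> disp k u v = \<tau>) * c (u k) (v k) * phase k u v)"
proof -
  have "(\<Sum>a<q. \<Sum>b<q. c a b * S k \<tau> a b) =
      (\<Sum>u\<in>vecs q k. \<Sum>v\<in>vecs q k. \<Sum>a<q. \<Sum>b<q. c a b *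
        (of_bool (u 1 = v 1 \<and> disp k u v = \<tau>) * of_bool (a = u k) * of_bool (b = v k) * phase k u v))"
    unfolding S_def sum_distrib_left
    by (simp only: sum.swap[where A = "{..<q}" and B = "vecs q k"])
  also have "\<dots> = (\<Sum>u\<in>vecs q k. \<Sum>v\<in>vecs q k.
      of_bool (u 1 = v 1 \<and> disp k u v = \<tau>) * c (u k) (v k) * phase k u v)"
  proof (intro sum.cong refl)
    fix u v assume "u \<in> vecs q k" "v \<in> vecs q k"
    then have "u k < q" "v k < q" using assms by (auto simp: vecs_def PiE_iff)
    have "(\<Sum>a<q. \<Sum>b<q. c a b *
        (of_bool (u 1 = v 1 \<and> disp k u v = \<tau>) * of_bool (a = u k) * of_bool (b = v k) * phase k u v))
      = (\<Sum>a<q. of_bool (a = u k) * (\<Sum>b<q. of_bool (b = v k) *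
          (of_bool (u 1 = v 1 \<and> disp k u v = \<tau>) * c a b * phase k u v)))"
      unfolding sum_distrib_left by (simp only: mult_ac)
    also have "\<dots> = of_bool (u 1 = v 1 \<and> disp k u v = \<tau>) * c (u k) (v k) * phase k u v"
      using \<open>u k < q\<close> \<open>v k < q\<close> by (simp only: sum_of_bool_lessThan)
    finally show "(\<Sum>a<q. \<Sum>b<q. c a b *
        (of_bool (u 1 = v 1 \<and> disp k u v = \<tau>) * of_bool (a = u k) * of_bool (b = v k) * phase k u v))
      = of_bool (u 1 = v 1 \<and> disp k u v = \<tau>) * c (u k) (v k) * phase k u v" .
  qed
  finally show ?thesis .
qed

section \<open>Recursion on the length of the path\<close>

lemma chain_Suc:
  assumes "k \<ge> 1"
  shows "chain (Suc k) (u(Suc k := a)) = chain k u + h k (u k) * h' k a + g (Suc k) a"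
proof -
  obtain n where k: "k = Suc n" using assms by (cases k) auto
  show ?thesis unfolding chain_def k
    by simp
qed

lemma disp_Suc:
  "disp (Suc k) (u(Suc k := a)) (v(Suc k := b)) = disp k u v + (int b - int a) * int q ^ e (Suc k)"
  by (simp add: disp_def)

text \<open>The new coordinate meets the old ones only through the last edge and a shift of the
  displacement; old pairs are grouped by their last coordinates \<open>y\<close>,
  \<open>y'\<close>.\<close>

lemma S_Suc:
  assumes "k \<ge> 1" "a < q" "b < q"
  shows "S (Suc k) \<tau> a b = xi q ^ g (Suc k) a * cnj (xi q ^ g (Suc k) b) *
    (\<Sum>y<q. \<Sum>y'<q. xi q ^ (h k y * h' k a) * cnj (xi q ^ (h k y' * h' k b)) *
       S k (\<tau> - (int b - int a) * int q ^ e (Suc k)) y y')"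
proof -
  let ?\<sigma> = "\<tau> - (int b - int a) * int q ^ e (Suc k)"
  let ?u = "\<lambda>u a. u(Suc k := a)"
  have ph: "phase (Suc k) (?u u a) (?u v b) =
      xi q ^ g (Suc k) a * cnj (xi q ^ g (Suc k) b) *
      (xi q ^ (h k (u k) * h' k a) * cnj (xi q ^ (h k (v k) * h' k b)) * phase k u v)" for u v
    using assms by (simp add: phase_def chain_Suc power_add mult_ac)
  have "S (Suc k) \<tau> a b = (\<Sum>u\<in>vecs q k. \<Sum>\<alpha><q. \<Sum>v\<in>vecs q k. \<Sum>\<beta><q.
      of_bool (u 1 = v 1 \<and> disp (Suc k) (?u u \<alpha>) (?u v \<beta>) = \<tau>) * of_bool (a = \<alpha>) *
      of_bool (b = \<beta>) * phase (Suc k) (?u u \<alpha>) (?u v \<beta>))"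
    \<comment> \<open>\<open>k \<ge> 1\<close> ensures that updating coordinate \<open>Suc k\<close>
      leaves the condition \<open>u 1 = v 1\<close> alone.\<close>
    using assms unfolding S_def sum_vecs_Suc by simp
  also have "\<dots> = (\<Sum>u\<in>vecs q k. \<Sum>v\<in>vecs q k. \<Sum>\<alpha><q. \<Sum>\<beta><q.
      of_bool (u 1 = v 1 \<and> disp (Suc k) (?u u \<alpha>) (?u v \<beta>) = \<tau>) * of_bool (a = \<alpha>) *
      of_bool (b = \<beta>) * phase (Suc k) (?u u \<alpha>) (?u v \<beta>))"
    by (simp only: sum.swap[where A = "{..<q}" and B = "vecs q k"])
  also have "\<dots> = (\<Sum>u\<in>vecs q k. \<Sum>v\<in>vecs q k. \<Sum>\<alpha><q. of_bool (a = \<alpha>) *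
      (\<Sum>\<beta><q. of_bool (b = \<beta>) * (of_bool (u 1 = v 1 \<and> disp (Suc k) (?u u \<alpha>) (?u v \<beta>) = \<tau>) *
      phase (Suc k) (?u u \<alpha>) (?u v \<beta>))))"
    unfolding sum_distrib_left by (simp only: mult_ac)
  also have "\<dots> = (\<Sum>u\<in>vecs q k. \<Sum>v\<in>vecs q k.
      of_bool (u 1 = v 1 \<and> disp (Suc k) (?u u a) (?u v b) = \<tau>) * phase (Suc k) (?u u a) (?u v b))"
    using assms by (simp only: sum_of_bool_lessThan)
  also have "\<dots> = xi q ^ g (Suc k) a * cnj (xi q ^ g (Suc k) b) *
    (\<Sum>u\<in>vecs q k. \<Sum>v\<in>vecs q k. of_bool (u 1 = v 1 \<and> disp k u v = ?\<sigma>) *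
       (xi q ^ (h k (u k) * h' k a) * cnj (xi q ^ (h k (v k) * h' k b))) * phase k u v)"
    unfolding ph disp_Suc sum_distrib_left
    by (intro sum.cong refl) (simp add: eq_diff_eq)
  also have "\<dots> = xi q ^ g (Suc k) a * cnj (xi q ^ g (Suc k) b) *
    (\<Sum>y<q. \<Sum>y'<q. xi q ^ (h k y * h' k a) * cnj (xi q ^ (h k y' * h' k b)) * S k ?\<sigma> y y')"
    by (subst sum_S[OF assms(1)]) (rule refl)
  finally show ?thesis .
qed

text \<open>Coordinate differences are signed digits of absolute value below \<open>q\<close>,
  placed at distinct powers.\<close>

lemma disp_eq_0:
  assumes "k \<le> m" "u \<in> vecs q k" "v \<in> vecs q k" "disp k u v = 0"
  shows "u = v"
proof
  fix i
  show "u i = v i"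
  proof (cases "i \<in> {1..k}")
    case True
    have "int (v i) - int (u i) = 0"
    proof (rule signed_digits_zero[of "{1..k}" e "\<lambda>i. int (v i) - int (u i)" q])
      show "inj_on e {1..k}" using e by (rule inj_on_subset) (use assms in auto)
      show "\<bar>int (v j) - int (u j)\<bar> < int q" if "j \<in> {1..k}" for j
      proof -
        have "u j < q" "v j < q" using that assms by (auto simp: vecs_def PiE_iff)
        then show ?thesis by linarith
      qed
    qed (use True assms in \<open>auto simp: disp_def\<close>)
    then show ?thesis by simp
  next
    case False
    then show ?thesis using assms by (auto simp: vecs_def PiE_iff extensional_def)
  qed
qed

lemma phase_diag: "phase k u u = 1"
  by (simp add: phase_def xi_cnj del: complex_cnj_power)

lemma disp_self: "disp k u u = 0"
  by (simp add: disp_def)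

text \<open>Displacement 0 leaves only the pairs \<open>u = v\<close>, of phase 1, and each last
  coordinate occurs in \<open>q ^ (k - 1)\<close> vectors.\<close>

lemma sum_S_0:
  assumes "1 \<le> k" "k \<le> m"
  shows "(\<Sum>a<q. \<Sum>b<q. c a b * S k 0 a b) = of_nat q ^ (k - 1) * (\<Sum>a<q. c a a)"
proof -
  have "(\<Sum>a<q. \<Sum>b<q. c a b * S k 0 a b) =
    (\<Sum>u\<in>vecs q k. \<Sum>v\<in>vecs q k. if v = u then c (u k) (u k) else 0)"
    unfolding sum_S[OF assms(1)]
  proof (intro sum.cong refl)
    fix u v assume uv: "u \<in> vecs q k" "v \<in> vecs q k"
    show "of_bool (u 1 = v 1 \<and> disp k u v = 0) * c (u k) (v k) * phase k u v =
        (if v = u then c (u k) (u k) else 0)"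
    proof (cases "v = u")
      case True
      then show ?thesis by (simp add: phase_diag disp_self)
    next
      case False
      then show ?thesis using disp_eq_0[OF assms(2) uv] by auto
    qed
  qed
  also have "\<dots> = (\<Sum>u\<in>vecs q k. c (u k) (u k))" by simp
  also obtain n where n: "k = Suc n" using assms by (cases k) auto
  have "(\<Sum>u\<in>vecs q k. c (u k) (u k)) = of_nat q ^ (k - 1) * (\<Sum>a<q. c a a)"
    unfolding n sum_vecs_Suc by (simp add: vecs_def card_PiE)
  finally show ?thesis .
qed

section \<open>Vanishing of the correlation sums, by induction along the path\<close>

lemma vanishing_1: "vanishing 1"
  \<comment> \<open>With a single coordinate, \<open>u 1 = v 1\<close> already forces displacement
    0.\<close>
  by (auto simp: vanishing_def S_def disp_def intro!: sum.neutral)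

text \<open>The displacements \<open>(b - a) * ?w\<close> lead back to \<open>S k 0\<close> and test
  orthogonality of the edge kernel; the others are governed by \<open>S k\<close> at nonzero
  displacement, recovered by Fourier inversion.\<close>

lemma vanishing_Suc:
  assumes "1 \<le> k" "k < m"
  shows "vanishing (Suc k) \<longleftrightarrow>
    vanishing k \<and> bij_betw (h k) {..<q} {..<q} \<and> bij_betw (h' k) {..<q} {..<q}"
proof -
  let ?w = "int q ^ e (Suc k)"
  have eq: "S (Suc k) ((int b - int a) * ?w) a b = xi q ^ g (Suc k) a * cnj (xi q ^ g (Suc k) b) *
      (of_nat q ^ (k - 1) * (\<Sum>y<q. xi q ^ (h k y * h' k a) * cnj (xi q ^ (h k y * h' k b))))"
    if "a < q" "b < q" for a b
    unfolding S_Suc[OF assms(1) that] using assms by (simp only: diff_self) (subst sum_S_0, auto)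
  have step: "S (Suc k) (\<tau> + (int b - int a) * ?w) a b = 0 \<longleftrightarrow>
      (\<Sum>y<q. \<Sum>y'<q. xi q ^ (h k y * h' k a) * cnj (xi q ^ (h k y' * h' k b)) * S k \<tau> y y') = 0"
    if "a < q" "b < q" for \<tau> :: int and a b
    unfolding S_Suc[OF assms(1) that] by simp
  show ?thesis
  proof
    assume van: "vanishing (Suc k)"
    have bij: "bij_betw (h k) {..<q} {..<q} \<and> bij_betw (h' k) {..<q} {..<q}"
    proof (rule bij_of_kernel_orthogonality)
      fix a b assume "a < q" "b < q" "a \<noteq> b"
      moreover from this have "S (Suc k) ((int b - int a) * ?w) a b = 0"
        using van q by (simp add: vanishing_def)
      ultimately show "(\<Sum>c<q. xi q ^ (h k c * h' k a) * cnj (xi q ^ (h k c * h' k b))) = 0"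
        using eq q by simp
    qed (use h[of k] h'[of k] assms in simp_all)
    moreover have "vanishing k"
      unfolding vanishing_def
    proof (intro allI impI, rule ccontr)
      fix \<tau> :: int and y y' assume \<tau>: "\<tau> \<noteq> 0" and y: "y < q" "y' < q" and nz: "S k \<tau> y y' \<noteq> 0"
      \<comment> \<open>For arbitrary \<tau> some shift \<open>\<tau> + (b - a) * ?w\<close> might
        be 0, where vanishing says nothing. A nonzero sum makes \<tau> an actual displacement, and
        uniqueness of signed digits then excludes this for all \<open>a\<close>,
        \<open>b\<close>.\<close>
      have "\<exists>u\<in>vecs q k. \<exists>v\<in>vecs q k. disp k u v = \<tau>"
      proof (rule ccontr)
        assume "\<not> ?thesis"
        then have "S k \<tau> y y' = 0" unfolding S_def by (intro sum.neutral ballI) auto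
        with nz show False ..
      qed
      then obtain u v where uv: "u \<in> vecs q k" "v \<in> vecs q k" "disp k u v = \<tau>" by blast
      have "\<tau> + (int b - int a) * ?w \<noteq> 0" if "a < q" "b < q" for a b
      proof
        let ?u = "u(Suc k := a)" and ?v = "v(Suc k := b)"
        assume "\<tau> + (int b - int a) * ?w = 0"
        then have "disp (Suc k) ?u ?v = 0" by (simp add: disp_Suc uv)
        moreover have "?u \<in> vecs q (Suc k)" "?v \<in> vecs q (Suc k)"
          using uv that by (auto simp: vecs_def PiE_iff extensional_def)
        ultimately have "?u = ?v" using assms disp_eq_0[of "Suc k"] by simp
        then have "\<And>i. i \<in> {1..k} \<Longrightarrow> u i = v i"
          by (auto dest: fun_cong[of ?u ?v] split: if_splits)
        then have "disp k u v = 0" by (simp add: disp_def)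
        with uv \<tau> show False by simp
      qed
      then have "S (Suc k) (\<tau> + (int b - int a) * ?w) a b = 0" if "a < q" "b < q" for a b
        using van that by (simp add: vanishing_def)
      then have "S k \<tau> y y' = 0"
        using bij y kernel_inversion2[of "h k" q "h' k" "S k \<tau>"] step by blast
      with nz show False ..
    qed
    ultimately show "vanishing k \<and> bij_betw (h k) {..<q} {..<q} \<and> bij_betw (h' k) {..<q} {..<q}"
      by blast
  next
    assume *: "vanishing k \<and> bij_betw (h k) {..<q} {..<q} \<and> bij_betw (h' k) {..<q} {..<q}"
    show "vanishing (Suc k)"
      unfolding vanishing_def
    proof (intro allI impI)
      fix \<tau> :: int and a b assume \<tau>: "\<tau> \<noteq> 0" and ab: "a < q" "b < q"
      show "S (Suc k) \<tau> a b = 0"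
      proof (cases "\<tau> = (int b - int a) * ?w")
        case True
        then have "a \<noteq> b" using \<tau> by auto
        then show ?thesis
          unfolding True eq[OF ab] using kernel_orthogonality[of "h k" q "h' k"] * ab by simp
      next
        case False
        then show ?thesis
          using * step[OF ab, of "\<tau> - (int b - int a) * ?w"] by (simp add: vanishing_def)
      qed
    qed
  qed
qed

lemma vanishing_iff:
  assumes "1 \<le> k" "k \<le> m"
  shows "vanishing k \<longleftrightarrow>
    (\<forall>i\<in>{1..k - 1}. bij_betw (h i) {..<q} {..<q} \<and> bij_betw (h' i) {..<q} {..<q})"
  using assms
proof (induction k rule: dec_induct)
  case base
  then show ?case using vanishing_1 by simp
next
  case (step n)
  have "{1..Suc n - 1} = insert n {1..n - 1}" using step by auto
  with step show ?case by (auto simp: vanishing_Suc)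
qed

end

section \<open>From correlations to correlation sums\<close>

text \<open>Both sign cases enumerate the index pairs with difference \<tau>, so one symmetric
  double sum serves for either sign.\<close>

lemma aper_corr_pairs:
  assumes "length a = L" "length b = L" "\<bar>\<tau>\<bar> < int L"
  shows "aper_corr a b \<tau> =
    (\<Sum>s<L. \<Sum>s'<L. of_bool (int s' - int s = \<tau>) * (a ! s * cnj (b ! s')))"
proof -
  have "aper_corr a b \<tau> =
      (\<Sum>(s, s')\<in>{(s, s'). s < L \<and> s' < L \<and> int s' - int s = \<tau>}. a ! s * cnj (b ! s'))"
  proof (cases "0 \<le> \<tau>")
    case True
    then have "aper_corr a b \<tau> = (\<Sum>s<nat (int L - \<tau>). a ! s * cnj (b ! (s + nat \<tau>)))"
      using assms by (simp add: aper_corr_def)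
    also have "\<dots> =
      (\<Sum>(s, s')\<in>{(s, s'). s < L \<and> s' < L \<and> int s' - int s = \<tau>}. a ! s * cnj (b ! s'))"
      by (rule sum.reindex_bij_witness[where i = fst and j = "\<lambda>s. (s, s + nat \<tau>)"])
        (use True in auto)
    finally show ?thesis .
  next
    case False
    then have "aper_corr a b \<tau> = (\<Sum>s<nat (int L + \<tau>). a ! (s + nat (- \<tau>)) * cnj (b ! s))"
      using assms by (simp add: aper_corr_def)
    also have "\<dots> =
      (\<Sum>(s, s')\<in>{(s, s'). s < L \<and> s' < L \<and> int s' - int s = \<tau>}. a ! s * cnj (b ! s'))"
      by (rule sum.reindex_bij_witness[where i = snd and j = "\<lambda>s. (s + nat (- \<tau>), s)"])
        (use False in auto)
    finally show ?thesis .
  qed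
  also have "\<dots> = (\<Sum>(s, s')\<in>{..<L} \<times> {..<L}.
      of_bool (int s' - int s = \<tau>) * (a ! s * cnj (b ! s')))"
    by (rule sum.mono_neutral_cong_left) auto
  finally show ?thesis by (simp only: sum.cartesian_product)
qed

text \<open>Path position \<open>i\<close> carries the variable with index \<open>\<pi> i\<close>,
  whose digit has weight \<open>q ^ (\<pi> i - 1)\<close>.\<close>

locale path_code = path_function q m h h' "\<lambda>i. g (\<pi> i)" "\<lambda>i. \<pi> i - Suc 0"
  for q m :: nat and h h' g :: "nat \<Rightarrow> nat \<Rightarrow> nat" and \<pi> :: "nat \<Rightarrow> nat" +
  assumes m: "m \<ge> 1" and \<pi>: "\<pi> permutes {1..m}"
begin

definition coords :: "nat \<Rightarrow> nat \<Rightarrow> nat" where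
  "coords n = (\<lambda>i\<in>{1..m}. digits q m n (\<pi> i))"

lemma \<pi>_in: "i \<in> {1..m} \<Longrightarrow> \<pi> i \<in> {1..m}"
  by (simp only: permutes_in_image[OF \<pi>])

lemma coords_in_vecs: "coords n \<in> vecs q m"
  using q \<pi>_in by (auto simp: coords_def digits_def vecs_def)

lemma coords_expansion:
  assumes "n < q ^ m"
  shows "n = (\<Sum>i = 1..m. coords n i * q ^ (\<pi> i - 1))"
proof -
  have "n = (\<Sum>j = 1..m. digits q m n j * q ^ (j - 1))"
    using digits_unique[OF q assms] by blast
  also have "\<dots> = (\<Sum>i = 1..m. digits q m n (\<pi> i) * q ^ (\<pi> i - 1))"
    by (subst sum.permute[OF \<pi>]) (simp add: o_def)
  finally show ?thesis by (simp add: coords_def)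
qed

text \<open>The expansion recovers the index, which gives injectivity; both sides have
  \<open>q ^ m\<close> elements.\<close>

lemma bij_coords: "bij_betw coords {..<q ^ m} (vecs q m)"
proof -
  have inj: "inj_on coords {..<q ^ m}"
  proof (rule inj_onI)
    fix s s' assume ss': "s \<in> {..<q ^ m}" "s' \<in> {..<q ^ m}" "coords s = coords s'"
    then have "s = (\<Sum>i = 1..m. coords s i * q ^ (\<pi> i - 1))"
      by (intro coords_expansion) simp
    also have "\<dots> = s'"
      unfolding ss'(3) using ss'(2) by (intro coords_expansion[symmetric]) simp
    finally show "s = s'" .
  qed
  have "card (coords ` {..<q ^ m}) = card (vecs q m)"
    using inj by (simp add: card_image vecs_def card_PiE)
  then have "coords ` {..<q ^ m} = vecs q m"
    by (intro card_subset_eq) (auto simp: coords_in_vecs)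
  with inj show ?thesis by (simp add: bij_betw_def)
qed

lemma disp_coords:
  assumes "n < q ^ m" "n' < q ^ m"
  shows "disp m (coords n) (coords n') = int n' - int n"
proof -
  have "int n = (\<Sum>i = 1..m. int (coords n i) * int q ^ (\<pi> i - 1))" if "n < q ^ m" for n
    using arg_cong[OF coords_expansion[OF that], of int] by simp
  then show ?thesis using assms
    by (simp add: disp_def left_diff_distrib sum_subtractf)
qed

lemma base_fun_digits: "base_fun q m h h' g \<pi> (digits q m n) = chain m (coords n) mod q"
proof -
  have "(\<Sum>j = 1..m. g j (digits q m n j)) = (\<Sum>i = 1..m. g (\<pi> i) (digits q m n (\<pi> i)))"
    by (subst sum.permute[OF \<pi>]) (simp add: o_def)
  moreover have "(\<Sum>i = 1..m - 1. h i (digits q m n (\<pi> i)) * h' i (digits q m n (\<pi> (i + 1)))) =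
      (\<Sum>i = 1..m - 1. h i (coords n i) * h' i (coords n (i + 1)))"
    by (intro sum.cong) (auto simp: coords_def)
  ultimately show ?thesis
    by (simp add: base_fun_def chain_def coords_def)
qed

section \<open>Correlations of the codes in terms of the path sums\<close>

abbreviation code :: "nat \<Rightarrow> complex list list" where
  "code \<equiv> psi_code q m (base_fun q m h h' g \<pi>) \<pi>"

lemma length_code: "length (code t) = q"
  by (simp add: psi_code_def)

lemma length_code_nth: "d < q \<Longrightarrow> length (code t ! d) = q ^ m"
  by (simp add: psi_code_def psi_def)

lemma code_nth:
  assumes "d < q" "n < q ^ m"
  shows "code t ! d ! n =
    xi q ^ (d * coords n 1) * xi q ^ (t * coords n m) * xi q ^ chain m (coords n)"
proof -
  have "code t ! d ! n = xi q ^ ((chain m (coords n) mod q + d * coords n 1 + t * coords n m) mod q)"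
    using assms m by (simp add: psi_code_def psi_def base_fun_digits coords_def)
  then show ?thesis
    using q by (simp add: xi_power_mod power_add mult_ac)
qed

text \<open>Orthogonality in \<open>d\<close> yields the factor \<open>q\<close> and the condition
  \<open>u 1 = v 1\<close>; the characters in \<open>t\<close>, \<open>t'\<close> are weights on the
  last coordinates.\<close>

lemma code_corr_eq:
  assumes "\<bar>\<tau>\<bar> < int (q ^ m)"
  shows "code_corr (code t) (code t') \<tau> =
    of_nat q * (\<Sum>a<q. \<Sum>b<q. xi q ^ (t * a) * cnj (xi q ^ (t' * b)) * S m \<tau> a b)"
proof -
  let ?c = "\<lambda>u v. xi q ^ (t * u m) * cnj (xi q ^ (t' * v m))"
  let ?L = "q ^ m"
  have "code_corr (code t) (code t') \<tau> = (\<Sum>d<q. \<Sum>s<?L. \<Sum>s'<?L.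
      of_bool (int s' - int s = \<tau>) * (code t ! d ! s * cnj (code t' ! d ! s')))"
    unfolding code_corr_def length_code using assms
    by (intro sum.cong refl aper_corr_pairs) (auto simp: length_code_nth)
  also have "\<dots> = (\<Sum>d<q. \<Sum>s<?L. \<Sum>s'<?L. of_bool (disp m (coords s) (coords s') = \<tau>) *
      (xi q ^ (d * coords s 1) * cnj (xi q ^ (d * coords s' 1)) * ?c (coords s) (coords s') *
       phase m (coords s) (coords s')))"
    by (intro sum.cong refl) (simp add: code_nth disp_coords phase_def mult_ac)
  also have "\<dots> = (\<Sum>d<q. \<Sum>u\<in>vecs q m. \<Sum>v\<in>vecs q m. of_bool (disp m u v = \<tau>) *
      (xi q ^ (d * u 1) * cnj (xi q ^ (d * v 1)) * ?c u v * phase m u v))"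
    by (simp only: sum.reindex_bij_betw[OF bij_coords, symmetric])
  also have "\<dots> = (\<Sum>u\<in>vecs q m. \<Sum>v\<in>vecs q m. \<Sum>d<q. of_bool (disp m u v = \<tau>) *
      (xi q ^ (d * u 1) * cnj (xi q ^ (d * v 1)) * ?c u v * phase m u v))"
    by (simp only: sum.swap[where A = "{..<q}" and B = "vecs q m"])
  also have "\<dots> = (\<Sum>u\<in>vecs q m. \<Sum>v\<in>vecs q m. of_nat q *
      (of_bool (u 1 = v 1 \<and> disp m u v = \<tau>) * ?c u v * phase m u v))"
  proof (intro sum.cong refl)
    fix u v assume "u \<in> vecs q m" "v \<in> vecs q m"
    then have "u 1 < q" "v 1 < q" using m by (auto simp: vecs_def PiE_iff)
    have "(\<Sum>d<q. of_bool (disp m u v = \<tau>) *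
        (xi q ^ (d * u 1) * cnj (xi q ^ (d * v 1)) * ?c u v * phase m u v)) =
      (\<Sum>d<q. xi q ^ (d * u 1) * cnj (xi q ^ (d * v 1))) *
        (of_bool (disp m u v = \<tau>) * ?c u v * phase m u v)"
      unfolding sum_distrib_right by (simp only: mult_ac)
    also have "\<dots> = of_nat q * (of_bool (u 1 = v 1 \<and> disp m u v = \<tau>) * ?c u v * phase m u v)"
      unfolding character_orthogonality[OF \<open>u 1 < q\<close> \<open>v 1 < q\<close>] by simp
    finally show "(\<Sum>d<q. of_bool (disp m u v = \<tau>) *
        (xi q ^ (d * u 1) * cnj (xi q ^ (d * v 1)) * ?c u v * phase m u v)) = \<dots>" .
  qed
  also have "\<dots> = of_nat q * (\<Sum>a<q. \<Sum>b<q. xi q ^ (t * a) * cnj (xi q ^ (t' * b)) * S m \<tau> a b)"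
    by (simp only: sum_S[OF m] sum_distrib_left)
  finally show ?thesis .
qed

text \<open>Only equal vectors contribute, leaving a character sum over the last coordinate. The
  required value thus holds for all maps \<open>h\<close>, \<open>h'\<close>, and only nonzero
  shifts carry information.\<close>

lemma code_corr_0:
  assumes "t < q" "t' < q"
  shows "code_corr (code t) (code t') 0 = of_bool (t = t') * of_nat (q * q ^ m)"
proof -
  obtain n where n: "m = Suc n" using m by (cases m) auto
  have "code_corr (code t) (code t') 0 =
      of_nat q * (of_nat q ^ (m - 1) * (\<Sum>a<q. xi q ^ (a * t) * cnj (xi q ^ (a * t'))))"
    using q m by (simp only: code_corr_eq sum_S_0 order_refl mult.commute[of _ t] mult.commute[of _ t'])
      (simp add: code_corr_eq sum_S_0 del: complex_cnj_power)
  then show ?thesis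
    unfolding character_orthogonality[OF assms] by (simp add: n)
qed

text \<open>Every displacement is a difference of two indices below \<open>q ^ m\<close>.\<close>

lemma S_out_of_range:
  assumes "\<not> \<bar>\<tau>\<bar> < int (q ^ m)"
  shows "S m \<tau> a b = 0"
proof -
  have "disp m u v \<noteq> \<tau>" if "u \<in> vecs q m" "v \<in> vecs q m" for u v
  proof -
    have "u \<in> coords ` {..<q ^ m}" "v \<in> coords ` {..<q ^ m}"
      using that bij_coords by (simp_all add: bij_betw_def)
    then obtain s s' where "s < q ^ m" "s' < q ^ m" "u = coords s" "v = coords s'" by blast
    then have "disp m u v = int s' - int s" "int s < int (q ^ m)" "int s' < int (q ^ m)"
      by (simp_all only: disp_coords of_nat_less_iff)
    then show ?thesis using assms by linarith
  qed
  then show ?thesis unfolding S_def by (intro sum.neutral ballI) auto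
qed

lemma is_CCC_iff_vanishing: "is_CCC q (q ^ m) (map code [0..<q]) \<longleftrightarrow> vanishing m"
proof -
  have key: "(code_corr (code t) (code t') \<tau> =
      (if \<tau> = 0 \<and> t = t' then of_nat (q * q ^ m) else 0)) =
      (\<tau> \<noteq> 0 \<longrightarrow> code_corr (code t) (code t') \<tau> = 0)"
    if "t < q" "t' < q" for t t' \<tau>
    using code_corr_0[OF that] by (cases "\<tau> = 0") (auto simp del: of_nat_mult of_nat_power)
  have "is_CCC q (q ^ m) (map code [0..<q]) \<longleftrightarrow>
      (\<forall>t<q. \<forall>t'<q. \<forall>\<tau>. \<bar>\<tau>\<bar> < int (q ^ m) \<longrightarrow> code_corr (code t) (code t') \<tau> =
        (if \<tau> = 0 \<and> t = t' then of_nat (q * q ^ m) else 0))"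
    by (auto simp: is_CCC_def length_code in_set_conv_nth length_code_nth)
  also have "\<dots> \<longleftrightarrow> (\<forall>\<tau>. \<tau> \<noteq> 0 \<longrightarrow> \<bar>\<tau>\<bar> < int (q ^ m) \<longrightarrow>
      (\<forall>t<q. \<forall>t'<q. code_corr (code t) (code t') \<tau> = 0))"
    using key by meson
  also have "\<dots> \<longleftrightarrow> vanishing m"
  proof
    assume *: "\<forall>\<tau>. \<tau> \<noteq> 0 \<longrightarrow> \<bar>\<tau>\<bar> < int (q ^ m) \<longrightarrow>
      (\<forall>t<q. \<forall>t'<q. code_corr (code t) (code t') \<tau> = 0)"
    show "vanishing m"
      unfolding vanishing_def
    proof (intro allI impI)
      fix \<tau> :: int and a b assume \<tau>: "\<tau> \<noteq> 0" and ab: "a < q" "b < q"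
      show "S m \<tau> a b = 0"
      proof (cases "\<bar>\<tau>\<bar> < int (q ^ m)")
        case True
        have "(\<Sum>a<q. \<Sum>b<q. xi q ^ (a * t) * cnj (xi q ^ (b * t')) * S m \<tau> a b) = 0"
          if "t < q" "t' < q" for t t'
          using * \<tau> True that q code_corr_eq[OF True, of t t'] by (simp add: mult.commute)
        \<comment> \<open>With identity maps the kernel is the ordinary Fourier kernel, and
          inversion in \<open>t\<close>, \<open>t'\<close> isolates the last coordinates.\<close>
        then show ?thesis
          using kernel_inversion2[of "\<lambda>a. a" q "\<lambda>a. a" "S m \<tau>"] ab by (simp add: bij_betw_def)
      qed (rule S_out_of_range)
    qed
  next
    assume "vanishing m"
    then show "\<forall>\<tau>. \<tau> \<noteq> 0 \<longrightarrow> \<bar>\<tau>\<bar> < int (q ^ m) \<longrightarrow>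
        (\<forall>t<q. \<forall>t'<q. code_corr (code t) (code t') \<tau> = 0)"
      by (simp add: code_corr_eq vanishing_def)
  qed
  finally show ?thesis .
qed

end

theorem theorem1:
  fixes q m :: nat
    and h h' g :: "nat \<Rightarrow> nat \<Rightarrow> nat"
    and \<pi> :: "nat \<Rightarrow> nat"
  assumes "q \<ge> 2" and "m \<ge> 2"
    and "\<And>i. i \<in> {1..m - 1} \<Longrightarrow> h i \<in> {..<q} \<rightarrow> {..<q}"
    and "\<And>i. i \<in> {1..m - 1} \<Longrightarrow> h' i \<in> {..<q} \<rightarrow> {..<q}"
    and "\<And>j. j \<in> {1..m} \<Longrightarrow> g j \<in> {..<q} \<rightarrow> {..<q}"
    and "\<pi> permutes {1..m}"
  shows "is_CCC q (q ^ m) (map (psi_code q m (base_fun q m h h' g \<pi>) \<pi>) [0..<q]) \<longleftrightarrow>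
    (\<forall>i\<in>{1..m - 1}. bij_betw (h i) ({..<q}) ({..<q}) \<and>
                      bij_betw (h' i) ({..<q}) ({..<q}))"
proof -
  have inj: "inj_on (\<lambda>i. \<pi> i - Suc 0) {1..m}"
  proof (rule inj_onI)
    fix i j assume ij: "i \<in> {1..m}" "j \<in> {1..m}" "\<pi> i - Suc 0 = \<pi> j - Suc 0"
    \<comment> \<open>Both values are at least 1, so the truncated subtraction loses
      nothing.\<close>
    then have "\<pi> i \<in> {1..m}" "\<pi> j \<in> {1..m}"
      by (simp_all only: permutes_in_image[OF assms(6)])
    with ij(3) have "\<pi> i = \<pi> j" by auto
    then show "i = j" using permutes_inj[OF assms(6)] by (simp add: inj_eq)
  qed
  interpret path_code q m h h' g \<pi>
  proof unfold_locales
    show "q > 0" "m \<ge> 1" using assms(1,2) by simp_all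
  qed (use assms(3,4,6) inj in blast)+
  show ?thesis
    using assms is_CCC_iff_vanishing vanishing_iff[of m] by simp
qed

end
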